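(* Let $B_X$ and $B_Y$ be the open unit balls of complex Banach spaces $X$ and $Y$, respectively, and let $f:B_X\to B_Y$ be a pluriharmonic mapping. Assume that $f$ is differentiable at a point $b\in\partial B_X$ with $|f(b)|=1$. Then $$|Df(b)b|\ \ge\ s^-(|f(0)|),\qquad\text{where } s^-(x)=\frac{2}{\pi}\cot\Big(\frac{\pi}{4}(1+x)\Big),\quad x\in(-1,1).$$
   Context: $|\cdot|$ denotes the norm of the Banach space in question. Let $\Omega$ be a domain in a complex Banach space $X$. A mapping $f$ of $\Omega$ into a (real or complex) Banach space $Y$ is pluriharmonic if the restriction of $l\circ f$ to every holomorphic curve is harmonic for every $l\in Y^*$ (the dual space of continuous linear functionals). Differentiability at a boundary point $b\in\partial B_X$ means: $f$ extends to $B_X\cup\{b\}$ (the extended value being $f(b)$) and there is a bounded real-linear operator $Df(b):X\to Y$ with $\frac{|f(b+h)-f(b)-Df(b)h|}{|h|}\to0$ as $h\to0$, $h\ne 0$, $b+h\in B_X$. *)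

theory Defs
  imports "HOL-Analysis.Analysis"
begin

class complex_banach = banach +
  fixes scaleC :: "complex \<Rightarrow> 'a \<Rightarrow> 'a"  (infixr "*\<^sub>C" 75)
  assumes scaleC_add_right: "c *\<^sub>C (x + y) = c *\<^sub>C x + c *\<^sub>C y"
    and scaleC_add_left: "(c + d) *\<^sub>C x = c *\<^sub>C x + d *\<^sub>C x"
    and scaleC_scaleC: "c *\<^sub>C d *\<^sub>C x = (c * d) *\<^sub>C x"
    and scaleC_of_real: "complex_of_real r *\<^sub>C x = r *\<^sub>R x"
    and norm_scaleC: "norm (c *\<^sub>C x) = cmod c * norm x"

instantiation complex :: complex_banach
begin

definition scaleC_complex_def: "c *\<^sub>C (x :: complex) = c * x"

instance
  by standard (simp_all add: scaleC_complex_def algebra_simps scaleR_conv_of_real norm_mult)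

end

definition complex_dual :: "('a::complex_banach \<Rightarrow> complex) set" where
  "complex_dual = {l. bounded_linear l \<and> (\<forall>c x. l (c *\<^sub>C x) = c * l x)}"

(* Frechet differentiability on an open subset of the plane with complex-linear derivative;
   a complex-linear map from the plane to X has the form h |-> h v with v in X. *)
definition holomorphic_curve_on :: "(complex \<Rightarrow> 'a::complex_banach) \<Rightarrow> complex set \<Rightarrow> bool" where
  "holomorphic_curve_on \<phi> U \<longleftrightarrow>
     open U \<and> (\<forall>z\<in>U. \<exists>v. (\<phi> has_derivative (\<lambda>h. h *\<^sub>C v)) (at z))"

(* C^2 with vanishing Laplacian: ux, uy are the first-order partial derivatives of u in
   z = x + iy, and uxy = d(ux)/dy, uyx = d(uy)/dx. For complex-valued u this says that the
   real and imaginary parts are harmonic. *)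
definition harmonic_on :: "(complex \<Rightarrow> 'b::real_normed_vector) \<Rightarrow> complex set \<Rightarrow> bool" where
  "harmonic_on u U \<longleftrightarrow>
     open U \<and>
     (\<exists>ux uy uxx uxy uyx uyy.
        (\<forall>z\<in>U. (u has_derivative (\<lambda>h. Re h *\<^sub>R ux z + Im h *\<^sub>R uy z)) (at z) \<and>
                (ux has_derivative (\<lambda>h. Re h *\<^sub>R uxx z + Im h *\<^sub>R uxy z)) (at z) \<and>
                (uy has_derivative (\<lambda>h. Re h *\<^sub>R uyx z + Im h *\<^sub>R uyy z)) (at z) \<and>
                uxx z + uyy z = 0) \<and>
        continuous_on U uxx \<and> continuous_on U uxy \<and>
        continuous_on U uyx \<and> continuous_on U uyy)"

(* The parameter domain U need not be connected; harmonicity being local, this agrees with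
   testing on curves defined on discs or on domains. *)
definition pluriharmonic_on ::
    "('a::complex_banach \<Rightarrow> 'b::complex_banach) \<Rightarrow> 'a set \<Rightarrow> bool" where
  "pluriharmonic_on f \<Omega> \<longleftrightarrow>
     (\<forall>l\<in>complex_dual. \<forall>\<phi> U. holomorphic_curve_on \<phi> U \<and> \<phi> ` U \<subseteq> \<Omega> \<longrightarrow>
        harmonic_on (l \<circ> f \<circ> \<phi>) U)"

definition s_minus :: "real \<Rightarrow> real" where
  "s_minus x = 2 / pi * cot (pi / 4 * (1 + x))"

end

(* A norming functional l of f b turns the slice of f along b into a harmonic function
   u z = Re (l (f (z b))) on the unit disc, with values in (-1, 1) and u 1 = 1. Write u = Re F with F
   holomorphic and F 0 real. Then H = tan (pi F / 4) maps the disc to itself, and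
   tan (pi |u| / 4) <= |H|, so Schwarz-Pick at the origin bounds tan (pi u r / 4) by
   (r + C) / (1 + C r), where C = tan (pi |f 0| / 4). Equality holds at r = 1, and comparing the
   derivatives there gives the claim. *)

theory Submission
  imports Defs "HOL-Complex_Analysis.Complex_Analysis"
begin

section \<open>Sublinear functionals, the Hahn-Banach theorem and norming functionals\<close>

text \<open>Homogeneity is asked for as an inequality, the form that passes directly to infima;
  \<open>sublinear_scaleR\<close> recovers equality.\<close>

definition sublinear :: "('a::real_vector \<Rightarrow> real) \<Rightarrow> bool" where
  "sublinear q \<longleftrightarrow> (\<forall>x y. q (x + y) \<le> q x + q y) \<and> (\<forall>t x. 0 \<le> t \<longrightarrow> q (t *\<^sub>R x) \<le> t * q x)"

lemma sublinear_zero: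
  assumes "sublinear q"
  shows "q 0 = 0"
proof -
  have "q (0 *\<^sub>R 0) \<le> 0 * q 0" "q (0 + 0) \<le> q 0 + q 0"
    using assms unfolding sublinear_def by blast+
  then show ?thesis by simp
qed

lemma sublinear_minus_le:
  assumes "sublinear q"
  shows "- q (- x) \<le> q x"
proof -
  have "q (x + - x) \<le> q x + q (- x)"
    using assms unfolding sublinear_def by blast
  then show ?thesis using sublinear_zero[OF assms] by simp
qed

lemma sublinear_scaleR:
  assumes "sublinear q" "0 \<le> t"
  shows "q (t *\<^sub>R x) = t * q x"
proof (cases "t = 0")
  case True
  then show ?thesis using sublinear_zero[OF assms(1)] by simp
next
  case False
  then have "t > 0" using assms by simp
  have "q ((1/t) *\<^sub>R t *\<^sub>R x) \<le> (1/t) * q (t *\<^sub>R x)" "q (t *\<^sub>R x) \<le> t * q x"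
    using assms(1) \<open>t > 0\<close> unfolding sublinear_def by (meson divide_nonneg_pos less_imp_le zero_le_one)+
  then show ?thesis using \<open>t > 0\<close> by (simp add: field_simps)
qed

lemma sublinear_norm: "sublinear (norm :: 'a::real_normed_vector \<Rightarrow> real)"
  by (simp add: sublinear_def norm_triangle_ineq)

text \<open>Serves two families: the shifts of one functional in \<open>sublinear_improve\<close>
  and the chains in Zorn's lemma. The index \<open>k\<close> may depend on the points, since only
  one member of the family below each right-hand side is required.\<close>

lemma sublinear_INF:
  assumes "I \<noteq> {}"
    and bdd: "\<And>x. bdd_below ((\<lambda>i. q i x) ` I)"
    and add: "\<And>i j x y. i \<in> I \<Longrightarrow> j \<in> I \<Longrightarrow> \<exists>k\<in>I. q k (x + y) \<le> q i x + q j y"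
    and scale: "\<And>i t x. i \<in> I \<Longrightarrow> 0 \<le> t \<Longrightarrow> \<exists>k\<in>I. q k (t *\<^sub>R x) \<le> t * q i x"
  shows "sublinear (\<lambda>x. INF i\<in>I. q i x)"
  unfolding sublinear_def
proof (intro conjI allI impI)
  fix x y
  have "(INF i\<in>I. q i (x + y)) - q j y \<le> (INF i\<in>I. q i x)" if j: "j \<in> I" for j
  proof (rule cINF_greatest[OF assms(1)])
    fix i assume "i \<in> I"
    then obtain k where "k \<in> I" "q k (x + y) \<le> q i x + q j y"
      using add j by blast
    then show "(INF i\<in>I. q i (x + y)) - q j y \<le> q i x"
      using cINF_lower[OF bdd \<open>k \<in> I\<close>, of "x + y"] by linarith
  qed
  then have "(INF i\<in>I. q i (x + y)) - (INF i\<in>I. q i x) \<le> (INF i\<in>I. q i y)"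
    by (intro cINF_greatest[OF assms(1)]) (simp add: algebra_simps)
  then show "(INF i\<in>I. q i (x + y)) \<le> (INF i\<in>I. q i x) + (INF i\<in>I. q i y)" by linarith
next
  fix t :: real and x assume "0 \<le> t"
  have le: "(INF i\<in>I. q i (t *\<^sub>R x)) \<le> t * q i x" if i: "i \<in> I" for i
  proof -
    obtain k where "k \<in> I" "q k (t *\<^sub>R x) \<le> t * q i x"
      using scale \<open>0 \<le> t\<close> i by blast
    then show ?thesis
      using cINF_lower[OF bdd \<open>k \<in> I\<close>, of "t *\<^sub>R x"] by linarith
  qed
  show "(INF i\<in>I. q i (t *\<^sub>R x)) \<le> t * (INF i\<in>I. q i x)"
  proof (cases "t = 0")
    case True
    then show ?thesis using le assms(1) by auto
  next
    case False
    then have "t > 0" using \<open>0 \<le> t\<close> by simp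
    then have "(INF i\<in>I. q i (t *\<^sub>R x)) / t \<le> (INF i\<in>I. q i x)"
      using le by (intro cINF_greatest[OF assms(1)]) (simp add: field_simps)
    then show ?thesis using \<open>t > 0\<close> by (simp add: field_simps)
  qed
qed

text \<open>The functional \<open>r\<close> is the infimum over t >= 0 of q (x + t y) - t q y. The
  choice t = 0 shows that it lies below \<open>q\<close>, and t = 1 at the point -y gives the last
  inequality.\<close>

lemma sublinear_improve:
  assumes q: "sublinear q"
  obtains r where "sublinear r" "\<And>x. r x \<le> q x" "r (- y) \<le> - q y"
proof
  let ?p = "\<lambda>t x. q (x + t *\<^sub>R y) - t * q y"
  let ?r = "\<lambda>x. INF t\<in>{0..}. ?p t x"
  have add: "q (x + z) \<le> q x + q z" for x z
    using q unfolding sublinear_def by blast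
  have bdd: "bdd_below ((\<lambda>t. ?p t x) ` {0..})" for x
  proof (rule bdd_belowI2)
    fix t :: real assume "t \<in> {0..}"
    then have "t * q y = q ((x + t *\<^sub>R y) + (- x))"
      using sublinear_scaleR[OF q] by simp
    also have "\<dots> \<le> q (x + t *\<^sub>R y) + q (- x)" by (rule add)
    finally show "- q (- x) \<le> ?p t x" by linarith
  qed
  show "sublinear ?r"
  proof (rule sublinear_INF[OF _ bdd])
    fix s t :: real and x z assume st: "s \<in> {0..}" "t \<in> {0..}"
    have "?p (s + t) (x + z) \<le> ?p s x + ?p t z"
      using add[of "x + s *\<^sub>R y" "z + t *\<^sub>R y"] by (simp add: algebra_simps)
    then show "\<exists>k\<in>{0..}. ?p k (x + z) \<le> ?p s x + ?p t z"
      using st by (intro bexI[of _ "s + t"]) auto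
  next
    fix s t :: real and x assume st: "s \<in> {0..}" "0 \<le> t"
    have "?p (t * s) (t *\<^sub>R x) = t * ?p s x"
      using sublinear_scaleR[OF q st(2), of "x + s *\<^sub>R y"] by (simp add: algebra_simps)
    then show "\<exists>k\<in>{0..}. ?p k (t *\<^sub>R x) \<le> t * ?p s x"
      using st by (intro bexI[of _ "t * s"]) auto
  qed simp
  show "?r x \<le> q x" for x
    using cINF_lower[OF bdd, of 0 x] by simp
  show "?r (- y) \<le> - q y"
    using cINF_lower[OF bdd, of 1 "- y"] sublinear_zero[OF q] by simp
qed

text \<open>Hahn--Banach without extending partial functionals: a minimal sublinear functional below \<open>q\<close>
  exists by Zorn's lemma, and \<open>sublinear_improve\<close> shows that it is odd, hence linear.\<close>

lemma sublinear_dominates_linear: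
  fixes q :: "'a::real_vector \<Rightarrow> real"
  assumes q: "sublinear q"
  obtains p where "linear p" "\<And>x. p x \<le> q x"
proof -
  let ?A = "{r. sublinear r \<and> (\<forall>x. r x \<le> q x)}"
  \<comment> \<open>The order is reversed: bounds of chains are lower bounds, and the maximal
    element from Zorn's lemma is a minimal functional.\<close>
  let ?P = "\<lambda>r s :: 'a \<Rightarrow> real. s \<le> r"
  have "\<exists>m\<in>?A. \<forall>a\<in>?A. ?P m a \<longrightarrow> a = m"
  proof (rule predicate_Zorn)
    show "partial_order_on ?A (relation_of ?P ?A)"
      by (auto simp: partial_order_on_def preorder_on_def refl_on_def trans_def antisym_def relation_of_def)
  next
    fix C assume C: "C \<in> Chains (relation_of ?P ?A)"
    then have CA: "r \<in> ?A" if "r \<in> C" for r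
      using that unfolding Chains_def relation_of_def by blast
    have chain: "r \<le> s \<or> s \<le> r" if "r \<in> C" "s \<in> C" for r s
      using that C unfolding Chains_def relation_of_def by blast
    show "\<exists>u\<in>?A. \<forall>r\<in>C. u \<le> r"
    proof (cases "C = {}")
      case True
      then show ?thesis using q by auto
    next
      case False
      let ?u = "\<lambda>x. INF r\<in>C. r x"
      \<comment> \<open>The bound -q (-x) is the same for every member of the chain, so the
        pointwise infimum is finite.\<close>
      have bdd: "bdd_below ((\<lambda>r. r x) ` C)" for x
      proof (rule bdd_belowI2)
        fix r assume "r \<in> C"
        then have "- r (- x) \<le> r x" "r (- x) \<le> q (- x)"
          using CA sublinear_minus_le by blast+
        then show "- q (- x) \<le> r x" by linarith
      qed
      have "sublinear ?u"
      proof (rule sublinear_INF[OF False bdd])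
        fix r s x y assume rs: "r \<in> C" "s \<in> C"
        have sub: "w (x + y) \<le> w x + w y" if "w \<in> C" for w
          using CA[OF that] unfolding sublinear_def by blast
        show "\<exists>k\<in>C. k (x + y) \<le> r x + s y"
        proof (cases "r \<le> s")
          case True
          then have "r (x + y) \<le> r x + s y"
            using sub[OF rs(1)] le_funD[OF True, of y] by linarith
          then show ?thesis using rs by blast
        next
          case False
          then have "s \<le> r" using chain rs by blast
          then have "s (x + y) \<le> r x + s y"
            using sub[OF rs(2)] le_funD[of s r x] by linarith
          then show ?thesis using rs by blast
        qed
      next
        fix r t x assume "r \<in> C" "0 \<le> (t::real)"
        then show "\<exists>k\<in>C. k (t *\<^sub>R x) \<le> t * r x"
          using CA[of r] unfolding sublinear_def by blast
      qed
      moreover have le: "?u \<le> r" if "r \<in> C" for r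
        using cINF_lower[OF bdd that] by (simp add: le_fun_def)
      moreover have "?u x \<le> q x" for x
      proof -
        obtain r where "r \<in> C" using False by blast
        then show ?thesis using le_funD[OF le, of r x] CA[of r] by (auto intro: order_trans)
      qed
      ultimately show ?thesis by blast
    qed
  qed
  then obtain p where p: "sublinear p" "\<And>x. p x \<le> q x"
    and min: "\<And>r. sublinear r \<Longrightarrow> r \<le> p \<Longrightarrow> r = p"
    by (smt (verit) le_funD le_funI mem_Collect_eq order_trans)
  \<comment> \<open>By minimality the improvement of \<open>p\<close> in direction \<open>y\<close>
    is \<open>p\<close> itself, so p (-y) <= -p y; the converse is subadditivity. Oddness then turns
    the inequalities of sublinearity into linearity.\<close>
  have odd: "p (- y) = - p y" for y
  proof -
    obtain r where r: "sublinear r" "\<And>x. r x \<le> p x" "r (- y) \<le> - p y"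
      using sublinear_improve[OF p(1)] by blast
    then have "r = p" using min by (simp add: le_fun_def)
    then show ?thesis using r(3) sublinear_minus_le[OF p(1), of "- y"] by simp
  qed
  have sub: "p (x + y) \<le> p x + p y" for x y
    using p(1) unfolding sublinear_def by blast
  have "linear p"
  proof (rule linearI)
    fix x y
    have "p x \<le> p (x + y) + p (- y)" using sub[of "x + y" "- y"] by simp
    then show "p (x + y) = p x + p y" using sub[of x y] odd[of y] by linarith
  next
    fix c x
    show "p (c *\<^sub>R x) = c *\<^sub>R p x"
    proof (cases "0 \<le> c")
      case True
      then show ?thesis using sublinear_scaleR[OF p(1)] by simp
    next
      case False
      then show ?thesis
        using sublinear_scaleR[OF p(1), of "- c" x] odd[of "c *\<^sub>R x"] by simp
    qed
  qed
  then show ?thesis using p(2) that by blast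
qed

text \<open>Improving the norm in direction \<open>y\<close> before dominating makes any linear
  \<open>p\<close> below the result satisfy p (-y) <= -norm y, hence p y >= norm y. No functional
  has to be extended from the line through \<open>y\<close>.\<close>

lemma norming_functional:
  fixes y :: "'a::real_normed_vector"
  obtains p :: "'a \<Rightarrow> real" where "linear p" "\<And>x. \<bar>p x\<bar> \<le> norm x" "p y = norm y"
proof -
  obtain r where r: "sublinear r" "\<And>x. r x \<le> norm x" "r (- y) \<le> - norm y"
    using sublinear_improve[OF sublinear_norm] by blast
  obtain p where p: "linear p" "\<And>x. p x \<le> r x"
    using sublinear_dominates_linear[OF r(1)] by blast
  have le: "p x \<le> norm x" for x using p(2) r(2) order_trans by blast
  have neg: "p (- x) = - p x" for x using p(1) by (rule linear_neg)
  have "\<bar>p x\<bar> \<le> norm x" for x using le[of x] le[of "- x"] neg[of x] by simp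
  moreover have "p y = norm y" using le[of y] p(2)[of "- y"] r(3) neg[of y] by linarith
  ultimately show ?thesis using that p(1) by blast
qed

text \<open>A complex-linear functional is determined by its real part \<open>p\<close> through l x
  = p x - i p (i x). Bounds on the real part are enough for the later estimates.\<close>

lemma norming_complex_dual:
  fixes y :: "'a::complex_banach"
  obtains l where "l \<in> complex_dual" "\<And>x. \<bar>Re (l x)\<bar> \<le> norm x" "Re (l y) = norm y"
proof -
  obtain p :: "'a \<Rightarrow> real" where p: "linear p" "\<And>x. \<bar>p x\<bar> \<le> norm x" "p y = norm y"
    using norming_functional by blast
  define l where "l x = Complex (p x) (- p (\<i> *\<^sub>C x))" for x
  have R: "r *\<^sub>R x = complex_of_real r *\<^sub>C x" for r and x :: 'a by (simp add: scaleC_of_real)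
  have hom: "l (c *\<^sub>C x) = c * l x" for c x
  proof -
    \<comment> \<open>Both c x and i (c x) are written as real combinations of x and i x, on which
      the real linearity of \<open>p\<close> can act.\<close>
    have c: "c *\<^sub>C x = Re c *\<^sub>R x + Im c *\<^sub>R (\<i> *\<^sub>C x)"
      unfolding R scaleC_scaleC scaleC_add_left[symmetric]
      by (rule arg_cong[where f = "\<lambda>d. d *\<^sub>C x"]) (simp add: complex_eq_iff)
    have ic: "\<i> *\<^sub>C (c *\<^sub>C x) = Re c *\<^sub>R (\<i> *\<^sub>C x) + (- Im c) *\<^sub>R x"
      unfolding R scaleC_scaleC scaleC_add_left[symmetric]
      by (rule arg_cong[where f = "\<lambda>d. d *\<^sub>C x"]) (simp add: complex_eq_iff)
    show ?thesis
      unfolding l_def ic unfolding c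
      by (simp add: complex_eq_iff linear_add[OF p(1)] linear_scale[OF p(1)] del: scaleR_minus_left add_uminus_conv_diff)
  qed
  have "bounded_linear l"
  proof (rule bounded_linear_intro)
    fix x z show "l (x + z) = l x + l z"
      by (simp add: l_def complex_eq_iff linear_add[OF p(1)] scaleC_add_right)
  next
    fix r x show "l (r *\<^sub>R x) = r *\<^sub>R l x"
      using hom[of "of_real r" x] by (simp add: scaleC_of_real scaleR_conv_of_real)
  next
    fix x
    have "cmod (l x) \<le> \<bar>p x\<bar> + \<bar>p (\<i> *\<^sub>C x)\<bar>"
      using cmod_le[of "l x"] by (simp add: l_def)
    also have "\<dots> \<le> norm x + norm (\<i> *\<^sub>C x)" using p(2) add_mono by blast
    finally show "cmod (l x) \<le> norm x * 2" by (simp add: norm_scaleC)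
  qed
  then have "l \<in> complex_dual" using hom by (simp add: complex_dual_def)
  then show ?thesis using that p by (simp add: l_def)
qed

section \<open>Planar harmonic functions as real parts of holomorphic functions\<close>

lemma has_derivative_horizontal:
  fixes u :: "complex \<Rightarrow> real"
  assumes "(u has_derivative (\<lambda>h. Re h * A + Im h * B)) (at (z + of_real s + \<i> * of_real t))"
  shows "((\<lambda>s. u (z + of_real s + \<i> * of_real t)) has_real_derivative A) (at s)"
proof -
  have "((\<lambda>s. z + of_real s + \<i> * of_real t) has_derivative (\<lambda>h. of_real h)) (at s)"
    by (auto intro!: derivative_eq_intros)
  from has_derivative_compose[OF this assms] show ?thesis
    by (simp add: has_field_derivative_def mult_commute_abs)
qed

lemma has_derivative_vertical:
  fixes u :: "complex \<Rightarrow> real"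
  assumes "(u has_derivative (\<lambda>h. Re h * A + Im h * B)) (at (z + of_real s + \<i> * of_real t))"
  shows "((\<lambda>t. u (z + of_real s + \<i> * of_real t)) has_real_derivative B) (at t)"
proof -
  have "((\<lambda>t. z + of_real s + \<i> * of_real t) has_derivative (\<lambda>h. \<i> * of_real h)) (at t)"
    by (auto intro!: derivative_eq_intros)
  from has_derivative_compose[OF this assms] show ?thesis
    by (simp add: has_field_derivative_def mult_commute_abs)
qed

text \<open>The second difference of \<open>u\<close> over a small square with corner
  \<open>z\<close> is evaluated by the mean value theorem in both orders. It equals the squared side
  times \<open>uxy\<close> at one point and times \<open>uyx\<close> at another, and both values are
  close to those at \<open>z\<close>.\<close>

lemma mixed_partials_eq:
  fixes u ux uy :: "complex \<Rightarrow> real"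
  assumes "open U" "z \<in> U"
    and u: "\<And>w. w \<in> U \<Longrightarrow> (u has_derivative (\<lambda>h. Re h * ux w + Im h * uy w)) (at w)"
    and ux: "\<And>w. w \<in> U \<Longrightarrow> (ux has_derivative (\<lambda>h. Re h * uxx w + Im h * uxy w)) (at w)"
    and uy: "\<And>w. w \<in> U \<Longrightarrow> (uy has_derivative (\<lambda>h. Re h * uyx w + Im h * uyy w)) (at w)"
    and cont: "continuous_on U uxy" "continuous_on U uyx"
  shows "uxy z = uyx z"
proof (rule ccontr)
  assume "uxy z \<noteq> uyx z"
  \<comment> \<open>Half the gap: a common value within \<open>e\<close> of both numbers would
    contradict the triangle inequality.\<close>
  define e where "e = \<bar>uxy z - uyx z\<bar> / 2"
  have "e > 0" using \<open>uxy z \<noteq> uyx z\<close> by (simp add: e_def)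
  have "(uxy \<longlongrightarrow> uxy z) (nhds z)" "(uyx \<longlongrightarrow> uyx z) (nhds z)"
    using cont assms(1,2) by (simp_all add: continuous_on_eq_continuous_at continuous_at tendsto_at_iff_tendsto_nhds)
  then have "eventually (\<lambda>w. w \<in> U \<and> dist (uxy w) (uxy z) < e \<and> dist (uyx w) (uyx z) < e) (nhds z)"
    using eventually_nhds_in_open[OF assms(1,2)] \<open>e > 0\<close> by (intro eventually_conj) (auto dest: tendstoD)
  then obtain d where "d > 0" and d: "\<And>w. dist w z < d \<Longrightarrow>
      w \<in> U \<and> dist (uxy w) (uxy z) < e \<and> dist (uyx w) (uyx z) < e"
    unfolding eventually_nhds_metric by blast
  \<comment> \<open>Points of the square lie within 2 h < d of \<open>z\<close>.\<close>
  define h where "h = d / 3"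
  define p where "p s t = z + of_real s + \<i> * of_real t" for s t
  have "h > 0" using \<open>d > 0\<close> by (simp add: h_def)
  have near: "dist (p s t) z < d" if "0 \<le> s" "s \<le> h" "0 \<le> t" "t \<le> h" for s t
  proof -
    have "dist (p s t) z \<le> cmod (of_real s) + cmod (\<i> * of_real t)"
      using norm_triangle_ineq[of "of_real s" "\<i> * of_real t"] by (simp add: p_def dist_norm)
    also have "\<dots> < d" using that \<open>d > 0\<close> by (simp add: norm_mult h_def)
    finally show ?thesis .
  qed
  have U: "p s t \<in> U" if "0 \<le> s" "s \<le> h" "0 \<le> t" "t \<le> h" for s t
    using d near that by blast
  have du: "((\<lambda>s. u (p s t)) has_real_derivative ux (p s t)) (at s)"
    "((\<lambda>t. u (p s t)) has_real_derivative uy (p s t)) (at t)"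
    "((\<lambda>t. ux (p s t)) has_real_derivative uxy (p s t)) (at t)"
    "((\<lambda>s. uy (p s t)) has_real_derivative uyx (p s t)) (at s)"
    if "0 \<le> s" "s \<le> h" "0 \<le> t" "t \<le> h" for s t
    using U[OF that] u ux uy unfolding p_def
    by (auto intro: has_derivative_horizontal has_derivative_vertical)
  have "\<exists>s. 0 < s \<and> s < h \<and> (u (p h h) - u (p h 0)) - (u (p 0 h) - u (p 0 0)) = (h - 0) * (ux (p s h) - ux (p s 0))"
    using \<open>h > 0\<close>
    by (intro MVT2[of 0 h "\<lambda>s. u (p s h) - u (p s 0)"]) (auto intro!: DERIV_diff du)
  then obtain s where s: "0 < s" "s < h"
    "(u (p h h) - u (p h 0)) - (u (p 0 h) - u (p 0 0)) = (h - 0) * (ux (p s h) - ux (p s 0))" by blast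
  have "\<exists>t. 0 < t \<and> t < h \<and> ux (p s h) - ux (p s 0) = (h - 0) * uxy (p s t)"
    using \<open>h > 0\<close> s by (intro MVT2) (auto intro!: du)
  then obtain t where t: "0 < t" "t < h" "ux (p s h) - ux (p s 0) = (h - 0) * uxy (p s t)" by blast
  \<comment> \<open>The same second difference, now regrouped as an increment in the vertical
    direction.\<close>
  have "\<exists>t. 0 < t \<and> t < h \<and> (u (p h h) - u (p 0 h)) - (u (p h 0) - u (p 0 0)) = (h - 0) * (uy (p h t) - uy (p 0 t))"
    using \<open>h > 0\<close>
    by (intro MVT2[of 0 h "\<lambda>t. u (p h t) - u (p 0 t)"]) (auto intro!: DERIV_diff du)
  then obtain t' where t': "0 < t'" "t' < h"
    "(u (p h h) - u (p 0 h)) - (u (p h 0) - u (p 0 0)) = (h - 0) * (uy (p h t') - uy (p 0 t'))" by blast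
  have "\<exists>s. 0 < s \<and> s < h \<and> uy (p h t') - uy (p 0 t') = (h - 0) * uyx (p s t')"
    using \<open>h > 0\<close> t' by (intro MVT2) (auto intro!: du)
  then obtain s' where s': "0 < s'" "s' < h" "uy (p h t') - uy (p 0 t') = (h - 0) * uyx (p s' t')" by blast
  have "(h - 0) * ((h - 0) * uxy (p s t)) = (h - 0) * ((h - 0) * uyx (p s' t'))"
    using s(3)[unfolded t(3)] t'(3)[unfolded s'(3)] by argo
  then have eq: "uxy (p s t) = uyx (p s' t')" using \<open>h > 0\<close> by simp
  have "dist (uxy (p s t)) (uxy z) < e" "dist (uyx (p s' t')) (uyx z) < e"
    using d near s(1,2) t(1,2) t'(1,2) s'(1,2) less_imp_le by meson+
  then show False
    using dist_triangle2[of "uxy z" "uyx z" "uxy (p s t)"] unfolding eq e_def by (simp add: dist_real_def abs_minus_commute)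
qed

lemma harmonic_on_bounded_linear:
  assumes "harmonic_on u U" "bounded_linear T"
  shows "harmonic_on (T \<circ> u) U"
proof -
  interpret T: bounded_linear T by fact
  obtain ux uy uxx uxy uyx uyy where
    d: "\<forall>z\<in>U. (u has_derivative (\<lambda>h. Re h *\<^sub>R ux z + Im h *\<^sub>R uy z)) (at z) \<and>
                (ux has_derivative (\<lambda>h. Re h *\<^sub>R uxx z + Im h *\<^sub>R uxy z)) (at z) \<and>
                (uy has_derivative (\<lambda>h. Re h *\<^sub>R uyx z + Im h *\<^sub>R uyy z)) (at z) \<and>
                uxx z + uyy z = 0"
    and c: "continuous_on U uxx" "continuous_on U uxy" "continuous_on U uyx" "continuous_on U uyy"
    and "open U"
    using assms(1) unfolding harmonic_on_def by blast
  have lin: "((T \<circ> v) has_derivative (\<lambda>h. Re h *\<^sub>R (T \<circ> vx) z + Im h *\<^sub>R (T \<circ> vy) z)) (at z)"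
    if "(v has_derivative (\<lambda>h. Re h *\<^sub>R vx z + Im h *\<^sub>R vy z)) (at z)" for v vx vy z
    using T.has_derivative[OF that] by (simp add: comp_def T.add T.scaleR)
  have cont: "continuous_on U (T \<circ> v)" if "continuous_on U v" for v
    using T.continuous_on[OF that] by (simp add: comp_def)
  have deriv: "((T \<circ> u) has_derivative (\<lambda>h. Re h *\<^sub>R (T \<circ> ux) z + Im h *\<^sub>R (T \<circ> uy) z)) (at z) \<and>
      ((T \<circ> ux) has_derivative (\<lambda>h. Re h *\<^sub>R (T \<circ> uxx) z + Im h *\<^sub>R (T \<circ> uxy) z)) (at z) \<and>
      ((T \<circ> uy) has_derivative (\<lambda>h. Re h *\<^sub>R (T \<circ> uyx) z + Im h *\<^sub>R (T \<circ> uyy) z)) (at z) \<and>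
      (T \<circ> uxx) z + (T \<circ> uyy) z = 0" if "z \<in> U" for z
    using d[rule_format, OF that] T.add[of "uxx z" "uyy z"] T.zero
    by (intro conjI lin) (simp_all only: comp_def)
  show ?thesis
    unfolding harmonic_on_def
    by (rule conjI[OF \<open>open U\<close>], rule exI[of _ "T \<circ> ux"], rule exI[of _ "T \<circ> uy"],
        rule exI[of _ "T \<circ> uxx"], rule exI[of _ "T \<circ> uxy"], rule exI[of _ "T \<circ> uyx"],
        rule exI[of _ "T \<circ> uyy"], intro conjI ballI deriv c[THEN cont])
qed

text \<open>If Re F = u, then F' = ux - i uy. This function satisfies the Cauchy-Riemann equations
  by the Laplace equation and the symmetry of mixed partials, so it has a primitive on the convex
  set, whose real part differs from \<open>u\<close> by a constant.\<close>

lemma harmonic_on_eq_Re_holomorphic: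
  fixes u :: "complex \<Rightarrow> real"
  assumes "harmonic_on u U" "convex U" "z0 \<in> U"
  obtains F where "F holomorphic_on U" "\<And>z. z \<in> U \<Longrightarrow> Re (F z) = u z" "Im (F z0) = 0"
proof -
  obtain ux uy uxx uxy uyx uyy where "open U"
    and u: "\<And>z. z \<in> U \<Longrightarrow> (u has_derivative (\<lambda>h. Re h * ux z + Im h * uy z)) (at z)"
    and ux: "\<And>z. z \<in> U \<Longrightarrow> (ux has_derivative (\<lambda>h. Re h * uxx z + Im h * uxy z)) (at z)"
    and uy: "\<And>z. z \<in> U \<Longrightarrow> (uy has_derivative (\<lambda>h. Re h * uyx z + Im h * uyy z)) (at z)"
    and lap: "\<And>z. z \<in> U \<Longrightarrow> uxx z + uyy z = 0"
    and c: "continuous_on U uxy" "continuous_on U uyx"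
    using assms(1) unfolding harmonic_on_def real_scaleR_def by blast
  define k where "k z = of_real (ux z) - \<i> * of_real (uy z)" for z
  have k: "(k has_field_derivative (of_real (uxx z) - \<i> * of_real (uyx z))) (at z)" if "z \<in> U" for z
  proof -
    have "uxy z = uyx z" using mixed_partials_eq[OF \<open>open U\<close> that u ux uy c] .
    moreover have "uyy z = - uxx z" using lap[OF that] by simp
    \<comment> \<open>The Cauchy-Riemann equations for \<open>k\<close>: its real derivative is
      multiplication by a complex number.\<close>
    ultimately have "(\<lambda>h. of_real (Re h * uxx z + Im h * uxy z) - \<i> * of_real (Re h * uyx z + Im h * uyy z))
        = (*) (of_real (uxx z) - \<i> * of_real (uyx z))"
      by (auto simp: complex_eq_iff algebra_simps)
    moreover have "(k has_derivative (\<lambda>h. of_real (Re h * uxx z + Im h * uxy z)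
        - \<i> * of_real (Re h * uyx z + Im h * uyy z))) (at z)"
      unfolding k_def[abs_def] by (intro derivative_intros ux[OF that] uy[OF that])
    ultimately show ?thesis by (simp add: has_field_derivative_def)
  qed
  then have "k holomorphic_on U"
    using holomorphic_on_open[OF \<open>open U\<close>] by blast
  then obtain G where G: "\<And>z. z \<in> U \<Longrightarrow> (G has_field_derivative k z) (at z within U)"
    using holomorphic_convex_primitive'[OF assms(2) \<open>open U\<close>] by blast
  have "((\<lambda>z. Re (G z) - u z) has_derivative (\<lambda>h. 0)) (at z within U)" if "z \<in> U" for z
  proof -
    have "((\<lambda>z. Re (G z) - u z) has_derivative
        (\<lambda>h. Re (k z * h) - (Re h * ux z + Im h * uy z))) (at z within U)"
      using G[OF that] u[OF that]
      by (intro derivative_intros) (auto simp: has_field_derivative_def intro: has_derivative_at_withinI)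
    then show ?thesis by (simp add: k_def algebra_simps)
  qed
  from has_derivative_zero_constant[OF assms(2) this]
  obtain C where C: "\<And>z. z \<in> U \<Longrightarrow> Re (G z) - u z = C" by auto
  show ?thesis
  proof
    \<comment> \<open>Subtracting \<open>C\<close> corrects the real part; subtracting the imaginary
      constant makes the value at \<open>z0\<close> real.\<close>
    show "(\<lambda>z. G z - of_real C - \<i> * of_real (Im (G z0))) holomorphic_on U"
      using G by (intro holomorphic_intros) (auto simp: holomorphic_on_def field_differentiable_def)
  qed (use C in \<open>auto simp: algebra_simps\<close>)
qed

section \<open>Schwarz-Pick at the origin and its harmonic counterpart\<close>

text \<open>After the Moebius map taking \<open>H 0\<close> to 0, the Schwarz lemma bounds the
  pseudohyperbolic distance of \<open>H z\<close> and \<open>H 0\<close> by the modulus of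
  \<open>z\<close>. Replacing both points by their moduli does not increase that distance, and the
  resulting real inequality is solved for the modulus of \<open>H z\<close>.\<close>

lemma Schwarz_Pick_zero:
  assumes H: "H holomorphic_on ball 0 1" and bound: "\<And>z. cmod z < 1 \<Longrightarrow> cmod (H z) < 1"
    and z: "cmod z < 1"
  shows "cmod (H z) \<le> (cmod z + cmod (H 0)) / (1 + cmod (H 0) * cmod z)"
proof -
  define w where "w = H 0"
  define x c r where "x = cmod (H z)" and "c = cmod w" and "r = cmod z"
  have x: "0 \<le> x" "x < 1" and c: "0 \<le> c" "c < 1" and r: "0 \<le> r" "r < 1"
    using bound[of z] bound[of 0] z by (auto simp: x_def c_def r_def w_def)
  have cx: "c * x < 1" using x c using mult_right_mono[of c 1 x] by simp
  let ?K = "Moebius_function 0 w \<circ> H"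
  have "?K holomorphic_on ball 0 1"
    using c bound by (intro holomorphic_on_compose_gen[OF H, of _ "ball 0 1"] Moebius_function_holomorphic)
      (auto simp: c_def)
  moreover have "cmod (?K z) < 1" if "cmod z < 1" for z
    using c bound[OF that] by (auto simp: c_def intro!: Moebius_function_norm_lt_1)
  moreover have "?K 0 = 0" by (simp add: w_def Moebius_function_eq_zero)
  ultimately have "cmod (?K z) \<le> r"
    unfolding r_def using z Schwarz_Lemma(1) by blast
  then have le: "cmod (H z - w) \<le> r * cmod (1 - cnj w * H z)"
  proof -
    have "cmod (cnj w * H z) < 1" using cx by (simp add: norm_mult x_def c_def)
    then have "1 - cnj w * H z \<noteq> 0" by auto
    then show ?thesis using \<open>cmod (?K z) \<le> r\<close>
      by (simp add: Moebius_function_simple norm_divide divide_le_eq)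
  qed
  have id: "(cmod (1 - cnj w * H z))\<^sup>2 - (cmod (H z - w))\<^sup>2 = (1 - c\<^sup>2) * (1 - x\<^sup>2)"
    unfolding c_def x_def cmod_power2 by (simp add: power2_eq_square algebra_simps)
  \<comment> \<open>Passage to moduli: \<open>id\<close> also holds with the real numbers
    \<open>c\<close> and \<open>x\<close> in place of the points, where the right-hand side is (1 -
    c x)^2 - (x - c)^2.\<close>
  have "1 - c * x \<le> cmod (1 - cnj w * H z)"
    using norm_triangle_ineq2[of 1 "cnj w * H z"] by (simp add: norm_mult c_def x_def)
  then have "(1 - c * x)\<^sup>2 * (1 - r\<^sup>2) \<le> (cmod (1 - cnj w * H z))\<^sup>2 * (1 - r\<^sup>2)"
    using cx r by (intro mult_right_mono power_mono) (auto simp: power_le_one)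
  also have "\<dots> \<le> (1 - c\<^sup>2) * (1 - x\<^sup>2)"
    using power_mono[OF le, of 2] id by (simp add: power_mult_distrib algebra_simps)
  finally have "(x - c)\<^sup>2 \<le> (r * (1 - c * x))\<^sup>2"
    by (simp add: power2_eq_square algebra_simps)
  then have "x - c \<le> r * (1 - c * x)"
    by (rule power2_le_imp_le) (use cx r in auto)
  then have "x * (1 + c * r) \<le> r + c" by (simp add: algebra_simps)
  then show ?thesis
    using c r by (simp add: x_def[symmetric] r_def[symmetric] c_def[symmetric] w_def[symmetric] pos_le_divide_eq add_pos_nonneg)
qed

text \<open>For z = x + i y, the squared moduli of sin z and cos z are sin^2 x + sinh^2 y and cos^2
  x + sinh^2 y. In the strip sin^2 x < cos^2 x, and adding the same nonnegative term to numerator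
  and denominator of a fraction below 1 raises it while keeping it below 1.\<close>

lemma norm_tan_strip:
  fixes z :: complex
  assumes "\<bar>Re z\<bar> < pi / 4"
  shows "cos z \<noteq> 0" "cmod (tan z) < 1" "tan \<bar>Re z\<bar> \<le> cmod (tan z)"
proof -
  \<comment> \<open>This is sinh^2 (Im z), in exponential form to match the formulas for the parts
    of sin and cos.\<close>
  define S where "S = ((exp (Im z) - exp (- Im z)) / 2)\<^sup>2"
  define X where "X = \<bar>Re z\<bar>"
  have "S \<ge> 0" by (simp add: S_def)
  have X: "0 \<le> X" "X < pi / 4" using assms by (auto simp: X_def)
  have e: "((exp (Im z) + exp (- Im z)) / 2)\<^sup>2 = 1 + S"
    by (simp add: S_def power2_eq_square field_simps exp_minus)
  have cX: "(cos (Re z))\<^sup>2 = (cos X)\<^sup>2" "(sin (Re z))\<^sup>2 = (sin X)\<^sup>2" by (auto simp: X_def abs_if)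
  have nc: "(cmod (cos z))\<^sup>2 = (cos X)\<^sup>2 + S"
  proof -
    have "(cmod (cos z))\<^sup>2 = (cos (Re z))\<^sup>2 * ((exp (Im z) + exp (- Im z)) / 2)\<^sup>2 + (sin (Re z))\<^sup>2 * S"
      unfolding cmod_power2 Re_cos Im_cos S_def by (simp add: power2_eq_square field_simps)
    then show ?thesis unfolding e cX sin_squared_eq by (simp add: algebra_simps)
  qed
  have ns: "(cmod (sin z))\<^sup>2 = (sin X)\<^sup>2 + S"
  proof -
    have "(cmod (sin z))\<^sup>2 = (sin (Re z))\<^sup>2 * ((exp (Im z) + exp (- Im z)) / 2)\<^sup>2 + (cos (Re z))\<^sup>2 * S"
      unfolding cmod_power2 Re_sin Im_sin S_def by (simp add: power2_eq_square field_simps)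
    then show ?thesis unfolding e cX cos_squared_eq by (simp add: algebra_simps)
  qed
  have "cos X > 0" using X by (intro cos_gt_zero_pi) auto
  have "sin X \<ge> 0" using X by (intro sin_ge_zero) auto
  have "sin X < cos X" using X sin_monotone_2pi[of X "pi/4"] cos_monotone_0_pi[of X "pi/4"]
    by (simp add: sin_45 cos_45)
  then have lt: "(sin X)\<^sup>2 < (cos X)\<^sup>2" using \<open>sin X \<ge> 0\<close> by (intro power_strict_mono) auto
  have cpos: "(cos X)\<^sup>2 > 0" using \<open>cos X > 0\<close> by simp
  have "(cmod (cos z))\<^sup>2 > 0" unfolding nc using cpos \<open>S \<ge> 0\<close> by (rule add_pos_nonneg)
  then show "cos z \<noteq> 0" by auto
  have t: "(cmod (tan z))\<^sup>2 = ((sin X)\<^sup>2 + S) / ((cos X)\<^sup>2 + S)"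
    by (simp add: tan_def norm_divide power_divide ns nc)
  have "(cmod (tan z))\<^sup>2 < 1\<^sup>2" unfolding t using lt add_pos_nonneg[OF cpos \<open>S \<ge> 0\<close>] by simp
  then show "cmod (tan z) < 1" by (rule power2_less_imp_less) simp
  have "(sin X)\<^sup>2 * S \<le> (cos X)\<^sup>2 * S" using lt \<open>S \<ge> 0\<close> by (intro mult_right_mono) auto
  then have "(sin X)\<^sup>2 / (cos X)\<^sup>2 \<le> ((sin X)\<^sup>2 + S) / ((cos X)\<^sup>2 + S)"
    using cpos add_pos_nonneg[OF cpos \<open>S \<ge> 0\<close>]
    by (simp only: pos_divide_le_eq pos_le_divide_eq times_divide_eq_left) (simp add: algebra_simps)
  then have "(tan X)\<^sup>2 \<le> (cmod (tan z))\<^sup>2"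
    unfolding t by (simp add: tan_def power_divide)
  then show "tan \<bar>Re z\<bar> \<le> cmod (tan z)"
    unfolding X_def by (rule power2_le_imp_le) simp
qed

text \<open>\<open>norm_tan_strip\<close> makes \<open>H\<close> a self-map of the disc, with the
  tangent of the real part below its modulus. Since F 0 is real, that comparison is an equality at
  the origin, so the constant is exactly \<open>c\<close>.\<close>

lemma harmonic_Schwarz:
  fixes u :: "complex \<Rightarrow> real"
  assumes "harmonic_on u (ball 0 1)" and bound: "\<And>z. cmod z < 1 \<Longrightarrow> \<bar>u z\<bar> < 1" and z: "cmod z < 1"
  defines "c \<equiv> tan (pi / 4 * \<bar>u 0\<bar>)"
  shows "tan (pi / 4 * \<bar>u z\<bar>) \<le> (cmod z + c) / (1 + c * cmod z)"
proof -
  obtain F where F: "F holomorphic_on ball 0 1" "\<And>z. z \<in> ball 0 1 \<Longrightarrow> Re (F z) = u z" "Im (F 0) = 0"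
    using harmonic_on_eq_Re_holomorphic[OF assms(1), of 0] by auto
  define H where "H z = tan (of_real (pi / 4) * F z)" for z
  have Re: "\<bar>Re (of_real (pi / 4) * F w)\<bar> = pi / 4 * \<bar>u w\<bar>" if "cmod w < 1" for w
    using F(2)[of w] that by (simp add: abs_mult)
  have strip: "\<bar>Re (of_real (pi / 4) * F w)\<bar> < pi / 4" if "cmod w < 1" for w
    unfolding Re[OF that] using bound[OF that] by simp
  note T = norm_tan_strip[OF strip]
  have "H holomorphic_on ball 0 1"
    unfolding H_def tan_def using T(1) by (intro holomorphic_intros F(1)) auto
  then have "cmod (H z) \<le> (cmod z + cmod (H 0)) / (1 + cmod (H 0) * cmod z)"
    using T(2) z unfolding H_def by (intro Schwarz_Pick_zero)
  moreover have "tan (pi / 4 * \<bar>u z\<bar>) \<le> cmod (H z)"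
    using T(3)[OF z] Re[OF z] by (simp add: H_def)
  moreover have "cmod (H 0) = c"
  proof -
    have "F 0 = of_real (u 0)" using F(2)[of 0] F(3) by (simp add: complex_eq_iff)
    then have "H 0 = of_real (tan (pi / 4 * u 0))"
      using tan_of_real[of "pi / 4 * u 0", where 'a = complex] by (simp add: H_def)
    moreover have "\<bar>tan (pi / 4 * u 0)\<bar> = tan (pi / 4 * \<bar>u 0\<bar>)"
    proof -
      have "0 \<le> tan (pi / 4 * \<bar>u 0\<bar>)"
        using bound[of 0] by (intro tan_pos_pi2_le) (auto simp: field_simps)
      then show ?thesis by (cases "u 0 \<ge> 0") auto
    qed
    ultimately show ?thesis by (simp add: c_def)
  qed
  ultimately show ?thesis by simp
qed

section \<open>Comparison of derivatives at the boundary, and the theorem\<close>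

text \<open>The gap \<open>w\<close> between the two sides of \<open>bound\<close> is nonnegative on
  [0, 1) and vanishes at 1, so its derivative from the left there is at most 0.\<close>

lemma boundary_derivative_bound:
  fixes v :: "real \<Rightarrow> real"
  assumes v: "(v has_real_derivative d) (at 1 within {0..<1})" "v 1 = 1"
    and "0 \<le> C"
    and bound: "\<And>r. 0 \<le> r \<Longrightarrow> r < 1 \<Longrightarrow> tan (pi / 4 * v r) \<le> (r + C) / (1 + C * r)"
  shows "2 / pi * ((1 - C) / (1 + C)) \<le> d"
proof -
  let ?S = "{0..<1::real}"
  define w where "w r = (r + C) / (1 + C * r) - tan (pi / 4 * v r)" for r
  \<comment> \<open>The factor is pi / 4 times the derivative of tan at pi / 4, which is 2.\<close>
  have "((\<lambda>r. tan (pi / 4 * v r)) has_real_derivative pi / 2 * d) (at 1 within ?S)"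
    using v by (auto intro!: derivative_eq_intros simp: cos_45 power_divide inverse_eq_divide)
  moreover have "((\<lambda>r. (r + C) / (1 + C * r)) has_real_derivative (1 - C) / (1 + C)) (at 1 within ?S)"
    using \<open>0 \<le> C\<close> by (auto intro!: derivative_eq_intros simp: divide_simps) (simp add: algebra_simps)
  ultimately have "(w has_real_derivative (1 - C) / (1 + C) - pi / 2 * d) (at 1 within ?S)"
    unfolding w_def[abs_def] by (rule DERIV_diff[rotated])
  then have lim: "((\<lambda>r. (w r - w 1) / (r - 1)) \<longlongrightarrow> (1 - C) / (1 + C) - pi / 2 * d) (at 1 within ?S)"
    by (simp add: has_field_derivative_iff)
  have "w 1 = 0" using v(2) \<open>0 \<le> C\<close> by (simp add: w_def tan_45 add.commute)
  then have "(w r - w 1) / (r - 1) \<le> 0" if "r \<in> ?S" for r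
    using bound[of r] that by (intro divide_nonneg_neg) (auto simp: w_def)
  then have ev: "eventually (\<lambda>r. (w r - w 1) / (r - 1) \<le> 0) (at 1 within ?S)"
    by (simp add: eventually_at_filter)
  have "at (1::real) within ?S \<noteq> bot"
    by (simp add: trivial_limit_within)
  with lim ev have "(1 - C) / (1 + C) - pi / 2 * d \<le> 0" by (rule tendsto_upperbound)
  moreover have "2 / pi * k \<le> d" if "k - pi / 2 * d \<le> 0" for k
    using that by (simp add: field_simps)
  ultimately show ?thesis by blast
qed

text \<open>The addition formulas give cot (pi/4 + x) = (1 - tan x) / (1 + tan x), which identifies
  the constant of \<open>boundary_derivative_bound\<close>.\<close>

lemma s_minus_eq:
  assumes "0 \<le> m" "m < 1"
  defines "C \<equiv> tan (pi / 4 * m)"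
  shows "s_minus m = 2 / pi * ((1 - C) / (1 + C))"
proof -
  define x where "x = pi / 4 * m"
  have x: "0 \<le> x" "x < pi / 4" using assms by (simp_all add: x_def)
  then have "cos x > 0" "sin x \<ge> 0" by (auto intro!: cos_gt_zero_pi sin_ge_zero)
  have x1: "pi / 4 * (1 + m) = pi / 4 + x" by (simp add: x_def algebra_simps)
  have "cot (pi / 4 + x) = (sqrt 2 / 2 * (cos x - sin x)) / (sqrt 2 / 2 * (cos x + sin x))"
    by (simp only: cot_def cos_add sin_add cos_45 sin_45 right_diff_distrib distrib_left)
  also have "\<dots> = (cos x - sin x) / (cos x + sin x)" by (rule mult_divide_mult_cancel_left) simp
  also have "\<dots> = (1 - tan x) / (1 + tan x)"
    using \<open>cos x > 0\<close> \<open>sin x \<ge> 0\<close> by (simp add: tan_def divide_simps)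
  finally show ?thesis unfolding s_minus_def x1 C_def x_def[symmetric] by simp
qed

theorem theorem3p1:
  fixes f :: "'a::complex_banach \<Rightarrow> 'b::complex_banach"
    and b :: 'a and D :: "'a \<Rightarrow> 'b"
  assumes "f ` ball 0 1 \<subseteq> ball 0 1"
    and "pluriharmonic_on f (ball 0 1)"
    and "b \<in> frontier (ball 0 1)"
    and "(f has_derivative D) (at b within ball 0 1)"
    and "norm (f b) = 1"
  shows "norm (D b) \<ge> s_minus (norm (f 0))"
proof -
  have b: "norm b = 1" using assms(3) by simp
  have f: "norm (f x) < 1" if "norm x < 1" for x
    using assms(1) that by (simp add: image_subset_iff)
  obtain l where l: "l \<in> complex_dual" "\<And>x. \<bar>Re (l x)\<bar> \<le> norm x" "Re (l (f b)) = 1"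
    using norming_complex_dual[of "f b"] assms(5) by metis
  then have bl: "bounded_linear l" by (simp add: complex_dual_def)
  define \<phi> where "\<phi> z = z *\<^sub>C b" for z
  have "bounded_linear \<phi>"
    by (rule bounded_linear_intro[of _ 1])
      (simp_all add: \<phi>_def scaleC_add_left norm_scaleC b scaleC_scaleC[symmetric] scaleR_conv_of_real
        flip: scaleC_of_real)
  then have "holomorphic_curve_on \<phi> (ball 0 1)"
    unfolding holomorphic_curve_on_def using bounded_linear_imp_has_derivative[of \<phi>] by (auto simp: \<phi>_def[abs_def])
  moreover have "\<phi> ` ball 0 1 \<subseteq> ball 0 1" by (auto simp: \<phi>_def norm_scaleC b)
  ultimately have "harmonic_on (l \<circ> f \<circ> \<phi>) (ball 0 1)"
    using assms(2) l(1) unfolding pluriharmonic_on_def by blast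
  then have harm: "harmonic_on (Re \<circ> (l \<circ> f \<circ> \<phi>)) (ball 0 1)"
    by (rule harmonic_on_bounded_linear) (rule bounded_linear_Re)
  have lt: "\<bar>(Re \<circ> (l \<circ> f \<circ> \<phi>)) z\<bar> < 1" if "cmod z < 1" for z
    using order_le_less_trans[OF l(2) f, of "\<phi> z"] that by (simp add: \<phi>_def norm_scaleC b)
  define v where "v r = Re (l (f (r *\<^sub>R b)))" for r
  define m where "m = norm (f 0)"
  define C where "C = tan (pi / 4 * m)"
  have m: "0 \<le> m" "m < 1" using f[of 0] by (auto simp: m_def)
  have "0 \<le> C" unfolding C_def using m by (intro tan_pos_pi2_le) (auto simp: field_simps)
  have "\<bar>v 0\<bar> \<le> m" using l(2) by (simp add: v_def m_def)
  \<comment> \<open>The slice only yields the Schwarz bound with \<open>c\<close>, since the real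
    part of l (f 0) can be smaller in modulus than the norm of f 0. The bound increases with the
    constant, so \<open>C\<close> may replace \<open>c\<close>.\<close>
  define c where "c = tan (pi / 4 * \<bar>v 0\<bar>)"
  have "0 \<le> pi / 4 * \<bar>v 0\<bar>" "pi / 4 * \<bar>v 0\<bar> \<le> pi / 4 * m" "pi / 4 * m < pi / 2"
    using m \<open>\<bar>v 0\<bar> \<le> m\<close> by (auto simp: field_simps)
  then have c: "0 \<le> c" "c \<le> C"
    unfolding c_def C_def using pi_gt_zero by (intro tan_pos_pi2_le tan_mono_le; linarith)+
  have "tan (pi / 4 * v r) \<le> (r + C) / (1 + C * r)" if r: "0 \<le> r" "r < 1" for r
  proof -
    have v_eq: "(Re \<circ> (l \<circ> f \<circ> \<phi>)) (of_real r) = v r" for r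
      by (simp add: v_def \<phi>_def scaleC_of_real)
    have "\<bar>v r\<bar> < 1" using lt[of "of_real r"] v_eq[of r] r by simp
    then have "\<bar>pi / 4 * v r\<bar> < pi / 2" by (simp add: abs_mult field_simps)
    moreover have "\<bar>pi / 4 * v r\<bar> = pi / 4 * \<bar>v r\<bar>" by (simp add: abs_mult)
    ultimately have "tan (pi / 4 * v r) \<le> tan (pi / 4 * \<bar>v r\<bar>)"
      by (intro tan_mono_le; linarith)
    also have "\<dots> \<le> (r + c) / (1 + c * r)"
      using harmonic_Schwarz[OF harm lt, of "of_real r"] v_eq[of r] v_eq[of 0] r by (simp add: c_def)
    also have "\<dots> \<le> (r + C) / (1 + C * r)"
    proof -
      \<comment> \<open>After cross-multiplication the two sides differ by (C - c) (1 -
        r^2).\<close>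
      have "(C - c) * r\<^sup>2 \<le> (C - c) * 1" using c r by (intro mult_left_mono power_le_one) auto
      then have "(r + c) * (1 + C * r) \<le> (r + C) * (1 + c * r)"
        by (simp add: algebra_simps power2_eq_square)
      moreover have "0 < 1 + c * r" "0 < 1 + C * r" using c r by (auto intro: add_pos_nonneg)
      ultimately show ?thesis by (simp only: pos_divide_le_eq pos_le_divide_eq times_divide_eq_left)
    qed
    finally show ?thesis .
  qed
  moreover have "(v has_real_derivative Re (l (D b))) (at 1 within {0..<1})"
  proof -
    have "((\<lambda>r. r *\<^sub>R b) has_derivative (\<lambda>h. h *\<^sub>R b)) (at 1 within {0..<1::real})"
      by (auto intro!: derivative_eq_intros)
    moreover have "(\<lambda>r. r *\<^sub>R b) ` {0..<1::real} \<subseteq> ball 0 1" using b by auto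
    \<comment> \<open>The radius [0, 1) b lies in the ball, so the derivative within the ball
      restricts to it and the one-sided chain rule applies.\<close>
    then have "(f has_derivative D) (at (1 *\<^sub>R b) within (\<lambda>r. r *\<^sub>R b) ` {0..<1::real})"
      using has_derivative_subset[OF assms(4)] by simp
    ultimately have "((\<lambda>r. f (r *\<^sub>R b)) has_derivative (\<lambda>h. D (h *\<^sub>R b))) (at 1 within {0..<1::real})"
      by (rule has_derivative_in_compose)
    then have "((\<lambda>r. Re (l (f (r *\<^sub>R b)))) has_derivative (\<lambda>h. Re (l (D (h *\<^sub>R b))))) (at 1 within {0..<1::real})"
      by (intro bounded_linear.has_derivative[OF bounded_linear_Re] bounded_linear.has_derivative[OF bl])
    moreover have "Re (l (D (h *\<^sub>R b))) = Re (l (D b)) * h" for h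
      using linear_scale[OF has_derivative_linear[OF assms(4)]] linear_scale[OF bounded_linear.linear[OF bl]] by simp
    ultimately show ?thesis by (simp add: has_field_derivative_def v_def[abs_def])
  qed
  moreover have "v 1 = 1" using l(3) by (simp add: v_def)
  ultimately have "2 / pi * ((1 - C) / (1 + C)) \<le> Re (l (D b))"
    using boundary_derivative_bound \<open>0 \<le> C\<close> by blast
  also have "\<dots> \<le> norm (D b)" using l(2)[of "D b"] by linarith
  finally show ?thesis using s_minus_eq[OF m] by (simp add: C_def m_def)
qed

end
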